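(* Let $k \geq 2$ and let $\alpha,\beta \in (0,1)$ be computable reals. If $\beta = \frac{k\alpha}{1+(k-1)\alpha}$, then $(\alpha,\beta) \notin \mathsf{EXT}(k)$.
   Context: $C$ denotes plain Kolmogorov complexity: $C(\sigma)=\min\{|p|:\mathbb{U}(p)=\sigma\}$ for a fixed optimal machine $\mathbb{U}$. For $k\ge1$, $\mathsf{EXT}(k)$ is the set of pairs $(\alpha,\beta)\in[0,1]^2$ for which there exist a total one-to-one computable $f:\mathbb{N}\to\mathbb{N}$, total computable $\Gamma_1,\ldots,\Gamma_k:\{0,1\}^*\to\{0,1\}^*$ and $d\in\mathbb{N}$ such that for all $n$ and every $\sigma$ with $|\sigma|=f(n)$: $|\Gamma_i(\sigma)|=n$ for all $i$, and if $C(\sigma)\ge\alpha|\sigma|+d$ then $C(\Gamma_i(\sigma))\ge\beta|\Gamma_i(\sigma)|-d$ for some $i$. *)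

theory Defs
  imports Complex_Main "HOL-Library.Nat_Bijection"
begin

definition mu_search :: "(nat \<rightharpoonup> nat) \<Rightarrow> nat \<rightharpoonup> nat" where
  "mu_search f a =
     (if \<exists>n. f (prod_encode (a, n)) = Some 0 \<and>
             (\<forall>m<n. \<exists>v. f (prod_encode (a, m)) = Some (Suc v))
      then Some (LEAST n. f (prod_encode (a, n)) = Some 0)
      else None)"

definition prim_rec :: "(nat \<rightharpoonup> nat) \<Rightarrow> (nat \<rightharpoonup> nat) \<Rightarrow> nat \<rightharpoonup> nat" where
  "prim_rec f g n =
     (case prod_decode n of (a, m) \<Rightarrow>
        rec_nat (f a)
          (\<lambda>y ih. Option.bind ih (\<lambda>i. g (prod_encode (a, prod_encode (y, i))))) m)"

text \<open>
  Kleene's partial recursive functions, presented as unary functions: the Cantor pairing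
  function and its projections (which are primitive recursive) take the place of arities
  and of composition with several arguments.
\<close>

inductive partrec :: "(nat \<rightharpoonup> nat) \<Rightarrow> bool" where
  zero: "partrec (\<lambda>n. Some 0)"
| succ: "partrec (\<lambda>n. Some (Suc n))"
| left: "partrec (\<lambda>n. Some (fst (prod_decode n)))"
| right: "partrec (\<lambda>n. Some (snd (prod_decode n)))"
| pair: "partrec f \<Longrightarrow> partrec g \<Longrightarrow>
    partrec (\<lambda>n. Option.bind (f n) (\<lambda>a. Option.bind (g n) (\<lambda>b. Some (prod_encode (a, b)))))"
| comp: "partrec f \<Longrightarrow> partrec g \<Longrightarrow> partrec (\<lambda>n. Option.bind (g n) f)"
| prec: "partrec f \<Longrightarrow> partrec g \<Longrightarrow> partrec (prim_rec f g)"
| mu: "partrec f \<Longrightarrow> partrec (mu_search f)"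

text \<open>Bijective base-2 numeration (least significant digit first) identifies binary strings
  with natural numbers.\<close>

fun str_encode :: "bool list \<Rightarrow> nat" where
  "str_encode [] = 0"
| "str_encode (b # \<sigma>) = 2 * str_encode \<sigma> + (if b then 2 else 1)"

lemma inj_str_encode: "inj str_encode"
proof (rule injI)
  show "str_encode \<sigma> = str_encode \<tau> \<Longrightarrow> \<sigma> = \<tau>" for \<sigma> \<tau>
  proof (induction \<sigma> arbitrary: \<tau>)
    case Nil
    then show ?case by (cases \<tau>) (auto split: if_splits)
  next
    case (Cons b \<sigma>)
    then obtain c \<tau>' where \<tau>: "\<tau> = c # \<tau>'"
      by (cases \<tau>) (auto split: if_splits)
    from Cons.prems have "b = c \<and> str_encode \<sigma> = str_encode \<tau>'"
      unfolding \<tau> by (auto split: if_splits) presburger+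
    with Cons.IH \<tau> show ?case by auto
  qed
qed

lemma surj_str_encode: "surj str_encode"
proof -
  have "\<exists>\<sigma>. str_encode \<sigma> = n" for n
  proof (induction n rule: less_induct)
    case (less n)
    show ?case
    proof (cases "n = 0")
      case True
      then show ?thesis by (intro exI[of _ "[]"]) simp
    next
      case False
      then have "(n - 1) div 2 < n" by simp
      then obtain \<sigma> where "str_encode \<sigma> = (n - 1) div 2"
        using less by blast
      with False have "str_encode (even n # \<sigma>) = n"
        by (simp, presburger)
      then show ?thesis by blast
    qed
  qed
  then show ?thesis by (metis surjI)
qed

lemma bij_str_encode: "bij str_encode"
  by (simp add: bij_def inj_str_encode surj_str_encode)

definition computable_nat :: "(nat \<Rightarrow> nat) \<Rightarrow> bool" where
  "computable_nat f \<longleftrightarrow> partrec (\<lambda>n. Some (f n))"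

type_synonym machine = "bool list \<rightharpoonup> bool list"

definition partial_computable :: "machine \<Rightarrow> bool" where
  "partial_computable M \<longleftrightarrow>
     (\<exists>g. partrec g \<and> (\<forall>p. g (str_encode p) = map_option str_encode (M p)))"

definition computable_str :: "(bool list \<Rightarrow> bool list) \<Rightarrow> bool" where
  "computable_str \<Gamma> \<longleftrightarrow> partial_computable (\<lambda>\<sigma>. Some (\<Gamma> \<sigma>))"

definition computable_real :: "real \<Rightarrow> bool" where
  "computable_real x \<longleftrightarrow>
     (\<exists>a b. computable_nat a \<and> computable_nat b \<and>
        (\<forall>n. \<bar>x - real_of_int (int_decode (a n)) / real (Suc (b n))\<bar> \<le> 1 / 2 ^ n))"

definition optimal_machine :: "machine \<Rightarrow> bool" where
  "optimal_machine U \<longleftrightarrow> partial_computable U \<and>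
     (\<forall>M. partial_computable M \<longrightarrow>
        (\<exists>c. \<forall>p \<sigma>. M p = Some \<sigma> \<longrightarrow> (\<exists>q. U q = Some \<sigma> \<and> length q \<le> length p + c)))"

text \<open>The minimum exists for every string whenever the machine is optimal.\<close>

definition plain_complexity :: "machine \<Rightarrow> bool list \<Rightarrow> nat" where
  "plain_complexity U \<sigma> = (LEAST l. \<exists>p. U p = Some \<sigma> \<and> length p = l)"

definition EXT :: "machine \<Rightarrow> nat \<Rightarrow> (real \<times> real) set" where
  "EXT U k =
     {(\<alpha>, \<beta>). \<alpha> \<in> {0..1} \<and> \<beta> \<in> {0..1} \<and>
        (\<exists>(f :: nat \<Rightarrow> nat) (\<Gamma> :: nat \<Rightarrow> bool list \<Rightarrow> bool list) (d :: nat).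
           inj f \<and> computable_nat f \<and> (\<forall>i\<in>{1..k}. computable_str (\<Gamma> i)) \<and>
           (\<forall>n \<sigma>. length \<sigma> = f n \<longrightarrow>
              (\<forall>i\<in>{1..k}. length (\<Gamma> i \<sigma>) = n) \<and>
              (real (plain_complexity U \<sigma>) \<ge> \<alpha> * real (length \<sigma>) + real d \<longrightarrow>
                (\<exists>i\<in>{1..k}. real (plain_complexity U (\<Gamma> i \<sigma>))
                               \<ge> \<beta> * real (length (\<Gamma> i \<sigma>)) - real d))))}"

end

theory Submission
  imports Defs
begin

text \<open>
  Put m = f(n). The assumption on \<beta> says that \<alpha>m = \<beta>n exactly when m = \<theta>n with
  \<theta> = k/(1 + (k-1)\<alpha>). It suffices to find, for every s, some n and a set A of strings of
  length m such that A has at least 2^(\<alpha>m + 2s) elements while the union B of its images under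
  the \<Gamma>_i has at most 2^(\<beta>n - 3s): a machine that searches for such n and B, given s,
  describes the elements of B with \<beta>n - 2s + O(1) bits, whereas some \<sigma> in A has complexity at
  least \<alpha>m + d.

  If m is smaller than \<theta>n by more than a constant, any A of the right size will do. If it is
  larger by more than a constant, restrict successively for each i to the t = 2^(\<beta>n - O(1))
  most popular values of \<Gamma>_i; each restriction keeps a fraction at least t/2^n of the strings.
  In the critical range this only yields O(t) strings, and the missing constant factor M comes
  from a pigeonhole argument. After restricting to the t most popular values of
  \<Gamma>_3, ..., \<Gamma>_k, keep the L t most popular values of \<Gamma>_1, for a large constant L, and
  cut them into L M blocks of t/M values. Now a value y of \<Gamma>_2 is taken at least 2M times on
  average. A y that is taken at least M times comes with a set of at most M blocks accounting for
  M of these occurrences. There are only 2^(L M) sets of blocks, so among many such y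
  at least t share the same set, whose union consists of at most t values. If there are few such y,
  they carry so many strings that the popularity argument suffices again.
\<close>

section \<open>Closure properties of computable functions\<close>

abbreviation pfst :: "nat \<Rightarrow> nat" where "pfst z \<equiv> fst (prod_decode z)"
abbreviation psnd :: "nat \<Rightarrow> nat" where "psnd z \<equiv> snd (prod_decode z)"

named_theorems computable_intros

lemma computable_nat_comp:
  assumes "computable_nat f" "computable_nat g"
  shows "computable_nat (\<lambda>e. f (g e))"
  using partrec.comp[of "\<lambda>n. Some (f n)" "\<lambda>n. Some (g n)"] assms by (simp add: computable_nat_def)

lemma computable_nat_pair [computable_intros]:
  assumes "computable_nat f" "computable_nat g"
  shows "computable_nat (\<lambda>e. prod_encode (f e, g e))"
  using partrec.pair[of "\<lambda>n. Some (f n)" "\<lambda>n. Some (g n)"] assms by (simp add: computable_nat_def)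

lemma computable_nat_pfst [computable_intros]: "computable_nat f \<Longrightarrow> computable_nat (\<lambda>e. pfst (f e))"
  using computable_nat_comp[of pfst f] partrec.left by (simp add: computable_nat_def)

lemma computable_nat_psnd [computable_intros]: "computable_nat f \<Longrightarrow> computable_nat (\<lambda>e. psnd (f e))"
  using computable_nat_comp[of psnd f] partrec.right by (simp add: computable_nat_def)

lemma computable_nat_Suc [computable_intros]: "computable_nat f \<Longrightarrow> computable_nat (\<lambda>e. Suc (f e))"
  using computable_nat_comp[of Suc f] partrec.succ by (simp add: computable_nat_def)

text \<open>The identity is not a generator of \<open>partrec\<close>; it is the pairing of the two
  projections.\<close>

lemma computable_nat_ident [computable_intros]: "computable_nat (\<lambda>e. e)"
proof -
  have "computable_nat pfst" "computable_nat psnd"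
    using partrec.left partrec.right by (simp_all add: computable_nat_def)
  from computable_nat_pair[OF this] show ?thesis by simp
qed

lemma computable_nat_const [computable_intros]: "computable_nat (\<lambda>e. c)"
proof (induction c)
  case 0
  then show ?case using partrec.zero by (simp add: computable_nat_def)
qed (rule computable_nat_Suc)

lemma computable_nat_comp2:
  assumes "computable_nat (\<lambda>z. F (pfst z) (psnd z))" "computable_nat f" "computable_nat g"
  shows "computable_nat (\<lambda>e. F (f e) (g e))"
  using computable_nat_comp[OF assms(1) computable_nat_pair[OF assms(2,3)]] by simp

text \<open>On total functions the \<open>Option.bind\<close> in \<open>prim_rec\<close> never
  fails, so the scheme computes an ordinary \<open>rec_nat\<close>. The argument \<open>e\<close> is
  carried along as the fixed parameter of the recursion.\<close>

lemma computable_nat_rec: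
  assumes "computable_nat f"
    and "computable_nat (\<lambda>z. G (pfst z) (pfst (psnd z)) (psnd (psnd z)))"
    and "computable_nat h"
  shows "computable_nat (\<lambda>e. rec_nat (f e) (G e) (h e))"
proof -
  define g where "g z = G (pfst z) (pfst (psnd z)) (psnd (psnd z))" for z
  have step: "rec_nat (Some (f a))
      (\<lambda>y ih. Option.bind ih (\<lambda>i. Some (g (prod_encode (a, prod_encode (y, i)))))) m
      = Some (rec_nat (f a) (G a) m)" for a m
    by (induction m) (simp_all add: g_def)
  have "prim_rec (\<lambda>n. Some (f n)) (\<lambda>n. Some (g n)) =
      (\<lambda>z. Some (rec_nat (f (pfst z)) (G (pfst z)) (psnd z)))"
    using step by (auto simp: prim_rec_def fun_eq_iff split: prod.split)
  moreover have "partrec (prim_rec (\<lambda>n. Some (f n)) (\<lambda>n. Some (g n)))"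
    using assms(1,2) unfolding computable_nat_def g_def by (intro partrec.prec)
  ultimately have "computable_nat (\<lambda>z. rec_nat (f (pfst z)) (G (pfst z)) (psnd z))"
    by (simp add: computable_nat_def)
  from computable_nat_comp2[OF this computable_nat_ident assms(3)] show ?thesis .
qed

section \<open>Arithmetic and bounded sums by primitive recursion\<close>

lemma computable_nat_add [computable_intros]:
  assumes "computable_nat f" "computable_nat g"
  shows "computable_nat (\<lambda>e. f e + g e)"
proof -
  have "a + m = rec_nat a (\<lambda>_ i. Suc i) m" for a m :: nat
    by (induction m) simp_all
  moreover have "computable_nat (\<lambda>e. rec_nat (f e) (\<lambda>_ i. Suc i) (g e))"
    by (intro computable_nat_rec computable_intros assms)
  ultimately show ?thesis by simp
qed

lemma computable_nat_mult [computable_intros]: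
  assumes "computable_nat f" "computable_nat g"
  shows "computable_nat (\<lambda>e. f e * g e)"
proof -
  have "a * m = rec_nat 0 (\<lambda>_ i. i + a) m" for a m :: nat
    by (induction m) simp_all
  moreover have "computable_nat (\<lambda>e. rec_nat 0 (\<lambda>_ i. i + f e) (g e))"
    by (intro computable_nat_rec computable_intros assms computable_nat_comp[OF assms(1)])
  ultimately show ?thesis by simp
qed

lemma computable_nat_power [computable_intros]:
  assumes "computable_nat f" "computable_nat g"
  shows "computable_nat (\<lambda>e. f e ^ g e)"
proof -
  have "a ^ m = rec_nat 1 (\<lambda>_ i. a * i) m" for a m :: nat
    by (induction m) simp_all
  moreover have "computable_nat (\<lambda>e. rec_nat 1 (\<lambda>_ i. f e * i) (g e))"
    by (intro computable_nat_rec computable_intros assms computable_nat_comp[OF assms(1)])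
  ultimately show ?thesis by simp
qed

lemma computable_nat_diff [computable_intros]:
  assumes "computable_nat f" "computable_nat g"
  shows "computable_nat (\<lambda>e. f e - g e)"
proof -
  \<comment> \<open>The predecessor is a recursion that ignores its previous value; truncated
    subtraction iterates it.\<close>
  have pred: "i - 1 = rec_nat 0 (\<lambda>y _. y) i" for i :: nat
    by (cases i) simp_all
  have diff: "rec_nat a (\<lambda>_ i. i - 1) m = a - m" for a m :: nat
    by (induction m) simp_all
  have "computable_nat (\<lambda>e. rec_nat (f e) (\<lambda>_ i. i - 1) (g e))"
    unfolding pred by (intro computable_nat_rec computable_intros assms)
  then show ?thesis by (simp only: diff)
qed

lemma computable_nat_sum [computable_intros]:
  assumes "computable_nat (\<lambda>z. F (pfst z) (psnd z))" "computable_nat h"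
  shows "computable_nat (\<lambda>e. \<Sum>j<h e. F e j)"
proof -
  have "(\<Sum>j<m. F e j) = rec_nat 0 (\<lambda>y i. i + F e y) m" for e m
    by (induction m) simp_all
  moreover have "computable_nat (\<lambda>e. rec_nat 0 (\<lambda>y i. i + F e y) (h e))"
    by (intro computable_nat_rec computable_intros assms computable_nat_comp2[OF assms(1)])
  ultimately show ?thesis by simp
qed

section \<open>Decidable predicates and unbounded search\<close>

definition decidable_nat :: "(nat \<Rightarrow> bool) \<Rightarrow> bool" where
  "decidable_nat P \<longleftrightarrow> computable_nat (\<lambda>e. of_bool (P e))"

lemma computable_nat_of_bool [computable_intros]: "decidable_nat P \<Longrightarrow> computable_nat (\<lambda>e. of_bool (P e))"
  by (simp add: decidable_nat_def)

lemma decidable_nat_const [computable_intros]: "decidable_nat (\<lambda>e. b)"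
  by (simp add: decidable_nat_def computable_intros)

lemma decidable_nat_le [computable_intros]:
  assumes "computable_nat f" "computable_nat g"
  shows "decidable_nat (\<lambda>e. f e \<le> g e)"
proof -
  have "of_bool (a \<le> b) = 1 - (a - b)" for a b :: nat by auto
  then show ?thesis unfolding decidable_nat_def by (simp only:) (intro computable_intros assms)
qed

lemma decidable_nat_not [computable_intros]:
  assumes "decidable_nat P"
  shows "decidable_nat (\<lambda>e. \<not> P e)"
proof -
  have "of_bool (\<not> p) = 1 - (of_bool p :: nat)" for p by auto
  then show ?thesis unfolding decidable_nat_def by (simp only:) (intro computable_intros assms)
qed

lemma decidable_nat_conj [computable_intros]:
  assumes "decidable_nat P" "decidable_nat Q"
  shows "decidable_nat (\<lambda>e. P e \<and> Q e)"
  unfolding decidable_nat_def of_bool_conj by (intro computable_intros assms)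

lemma decidable_nat_less [computable_intros]:
  assumes "computable_nat f" "computable_nat g"
  shows "decidable_nat (\<lambda>e. f e < g e)"
  unfolding less_eq_Suc_le by (intro computable_intros assms)

lemma decidable_nat_eq [computable_intros]:
  assumes "computable_nat f" "computable_nat g"
  shows "decidable_nat (\<lambda>e. f e = g e)"
  unfolding eq_iff[where 'a = nat] by (intro computable_intros assms)

lemma decidable_nat_bex [computable_intros]:
  assumes "decidable_nat (\<lambda>z. P (pfst z) (psnd z))" "computable_nat h"
  shows "decidable_nat (\<lambda>e. \<exists>j<h e. P e j)"
proof -
  have "(\<exists>j<m. P e j) \<longleftrightarrow> 0 < (\<Sum>j<m. of_bool (P e j) :: nat)" for e m
    by (auto simp: sum_pos2 simp flip: neq0_conv)
  then show ?thesis by (simp only:) (intro computable_intros assms)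
qed

lemma decidable_nat_ball:
  assumes "finite I" "\<And>i. i \<in> I \<Longrightarrow> decidable_nat (P i)"
  shows "decidable_nat (\<lambda>e. \<forall>i\<in>I. P i e)"
  using assms by (induction I) (simp_all add: computable_intros)

text \<open>\<open>mu_search\<close> looks for a zero, hence the negation. Only the argument
  \<open>a\<close> itself needs a witness, so the lemma also serves searches that diverge
  elsewhere.\<close>

lemma mu_search_total:
  assumes "\<exists>n. P a n"
  shows "mu_search (\<lambda>z. Some (of_bool (\<not> P (pfst z) (psnd z)))) a = Some (LEAST n. P a n)"
proof -
  have "P a (LEAST n. P a n)" using assms by (rule LeastI_ex)
  moreover have "\<not> P a m" if "m < (LEAST n. P a n)" for m using that by (rule not_less_Least)
  ultimately have "\<exists>n. P a n \<and> (\<forall>m<n. \<not> P a m)" by blast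
  then show ?thesis by (auto simp: mu_search_def of_bool_def)
qed

lemma computable_nat_Least [computable_intros]:
  assumes "decidable_nat (\<lambda>z. P (pfst z) (psnd z))" "\<And>e. \<exists>n. P e n"
  shows "computable_nat (\<lambda>e. LEAST n. P e n)"
proof -
  have "partrec (mu_search (\<lambda>z. Some (of_bool (\<not> P (pfst z) (psnd z)))))"
    using decidable_nat_not[OF assms(1)] unfolding decidable_nat_def computable_nat_def
    by (rule partrec.mu)
  moreover have "mu_search (\<lambda>z. Some (of_bool (\<not> P (pfst z) (psnd z)))) = (\<lambda>e. Some (LEAST n. P e n))"
    by (intro ext mu_search_total assms(2))
  ultimately show ?thesis by (simp only: computable_nat_def)
qed

text \<open>The quotient is the least \<open>q\<close> with \<open>f e < Suc q * Suc (g e)\<close>;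
  a divisor of the form \<open>Suc\<close> makes this search total.\<close>

lemma computable_nat_div_Suc [computable_intros]:
  assumes "computable_nat f" "computable_nat g"
  shows "computable_nat (\<lambda>e. f e div Suc (g e))"
proof -
  have div: "(LEAST q. a < Suc q * Suc b) = a div Suc b" for a b :: nat
  proof (rule Least_equality)
    show "a < Suc (a div Suc b) * Suc b" using dividend_less_div_times[of "Suc b" a] by simp
    show "a div Suc b \<le> q" if "a < Suc q * Suc b" for q
      using less_mult_imp_div_less[OF that] by simp
  qed
  have "computable_nat (\<lambda>e. LEAST q. f e < Suc q * Suc (g e))"
  proof (intro computable_intros computable_nat_comp[OF assms(1)] computable_nat_comp[OF assms(2)])
    show "\<exists>q. f e < Suc q * Suc (g e)" for e by (intro exI[of _ "f e"]) simp
  qed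
  then show ?thesis by (simp only: div)
qed

text \<open>The \<open>n\<close>-th approximation is off by at most 2^-n, so its multiple by
  \<open>n\<close> is off by at most 1; rounding down costs at most 1 more.\<close>

lemma computable_real_multiples:
  assumes "computable_real x" "0 \<le> x"
  shows "\<exists>r. computable_nat r \<and> (\<forall>n. \<bar>real (r n) - x * real n\<bar> \<le> 2)"
proof -
  obtain a b where ab: "computable_nat a" "computable_nat b"
      "\<And>n. \<bar>x - real_of_int (int_decode (a n)) / real (Suc (b n))\<bar> \<le> 1 / 2 ^ n"
    using assms(1) unfolding computable_real_def by blast
  \<comment> \<open>The numerator cut off at 0: \<open>int_decode\<close> reads even codes as
    nonnegative and odd codes as negative integers.\<close>
  define p where "p n = of_bool (2 * (a n div Suc 1) = a n) * (a n div Suc 1)" for n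
  have p_even: "p n = (if even (a n) then a n div 2 else 0)" for n
    by (auto simp: p_def numeral_2_eq_2[symmetric])
  define r where "r n = p n * n div Suc (b n)" for n
  have "computable_nat p" unfolding p_def by (intro computable_intros ab)
  then have "computable_nat r" unfolding r_def by (intro computable_intros ab)
  moreover have "\<bar>real (r n) - x * real n\<bar> \<le> 2" for n
  proof -
    define i where "i = int_decode (a n)"
    have p: "p n = nat i"
      unfolding p_even i_def by (auto simp: int_decode_def sum_decode_def)
    define q where "q = real_of_int i / real (Suc (b n))"
    define q' where "q' = real (p n) / real (Suc (b n))"
    have q: "\<bar>x - q\<bar> \<le> 1 / 2 ^ n" using ab(3)[of n] by (simp add: q_def i_def)
    \<comment> \<open>Replacing a negative approximation by 0 only brings it closer to
      \<open>x\<close>, as \<open>x\<close> is nonnegative.\<close>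
    have "\<bar>x - q'\<bar> \<le> \<bar>x - q\<bar>"
    proof (cases "0 \<le> i")
      case False
      then have "q \<le> 0" by (simp add: q_def divide_nonpos_pos)
      then show ?thesis using False assms(2) by (simp add: q'_def p)
    qed (simp add: q'_def q_def p)
    then have "\<bar>x - q'\<bar> * real n \<le> 1 / 2 ^ n * real n" using q by (intro mult_right_mono) auto
    also have "\<dots> \<le> 1" by (simp add: field_simps less_imp_le[OF of_nat_less_two_power])
    finally have 1: "\<bar>x * real n - q' * real n\<bar> \<le> 1" by (simp add: abs_mult flip: left_diff_distrib)
    have "real (r n) \<le> real (p n * n) / real (Suc (b n))"
      unfolding r_def by (rule of_nat_div_le_of_nat)
    moreover have "real (p n * n) / real (Suc (b n)) - 1 \<le> real (r n)"
    proof -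
      have "p n * n < Suc (r n) * Suc (b n)"
        using dividend_less_div_times[of "Suc (b n)" "p n * n"] by (simp add: r_def)
      then have "real (p n * n) \<le> real (Suc (r n)) * real (Suc (b n))"
        unfolding of_nat_mult[symmetric] of_nat_le_iff by simp
      then have "real (p n * n) / real (Suc (b n)) \<le> real (Suc (r n))"
        by (simp only: pos_divide_le_eq of_nat_0_less_iff zero_less_Suc)
      then show ?thesis by simp
    qed
    ultimately have "\<bar>real (r n) - q' * real n\<bar> \<le> 1" by (simp add: q'_def)
    with 1 show ?thesis by linarith
  qed
  ultimately show ?thesis by blast
qed

text \<open>A number codes an infinite sequence by iterated pairing, so that every finite sequence is a
  prefix of a coded one.\<close>

definition code_nth :: "nat \<Rightarrow> nat \<Rightarrow> nat" where
  "code_nth b j = pfst ((psnd ^^ j) b)"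

lemma computable_nat_code_nth [computable_intros]:
  assumes "computable_nat f" "computable_nat g"
  shows "computable_nat (\<lambda>e. code_nth (f e) (g e))"
proof -
  have "(psnd ^^ j) b = rec_nat b (\<lambda>_ i. psnd i) j" for b j
    by (induction j) simp_all
  then show ?thesis
    unfolding code_nth_def by (simp only:) (intro computable_intros computable_nat_rec assms)
qed

lemma code_nth_surj: "\<exists>b. \<forall>j<T. code_nth b j = h j"
proof (induction T arbitrary: h)
  case (Suc T)
  obtain b where b: "\<forall>j<T. code_nth b j = h (Suc j)" using Suc[of "\<lambda>j. h (Suc j)"] by blast
  have "code_nth (prod_encode (h 0, b)) j = h j" if "j < Suc T" for j
    using b that by (cases j) (auto simp: code_nth_def funpow_Suc_right simp del: funpow.simps(2))
  then show ?case by blast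
qed simp

section \<open>Splitting a positive number into a power of two and an odd factor\<close>

lemma odd_decomposition: "\<exists>s j. Suc x = 2 ^ s * Suc (2 * j)"
proof (induction x rule: less_induct)
  case (less x)
  show ?case
  proof (cases "even x")
    case True
    then show ?thesis by (intro exI[of _ 0] exI[of _ "x div 2"]) simp
  next
    case False
    then have "x div 2 < x" by (cases x) auto
    then obtain s j where sj: "Suc (x div 2) = 2 ^ s * Suc (2 * j)" using less by blast
    have "Suc x = 2 * Suc (x div 2)" using False by presburger
    also have "\<dots> = 2 ^ Suc s * Suc (2 * j)" unfolding sj by simp
    finally show ?thesis by blast
  qed
qed

text \<open>Justifies the bounded quantifier over \<open>j\<close> in \<open>odd_exp\<close>, which
  makes the body of that search decidable.\<close>

lemma odd_decomposition_bound:
  assumes "Suc x = 2 ^ s * Suc (2 * j)"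
  shows "j < Suc x"
proof -
  have "1 * Suc (2 * j) \<le> 2 ^ s * Suc (2 * j)" by (intro mult_le_mono1) simp
  then have "Suc (2 * j) \<le> Suc x" by (simp only: assms mult_1)
  then show ?thesis by simp
qed

lemma odd_decomposition_unique:
  "(2::nat) ^ s * Suc (2 * j) = 2 ^ s' * Suc (2 * j') \<Longrightarrow> s = s' \<and> j = j'"
proof (induction s arbitrary: s')
  case 0
  then show ?case by (cases s') (simp, simp, presburger)
next
  case (Suc s)
  then show ?case
  proof (cases s')
    case 0
    then have "2 * (2 ^ s * Suc (2 * j)) = Suc (2 * j')" using Suc.prems by simp
    then show ?thesis by presburger
  next
    case (Suc t)
    then have "2 * (2 ^ s * Suc (2 * j)) = 2 * (2 ^ t * Suc (2 * j'))"
      using Suc.prems by (simp only: power_Suc mult.assoc)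
    then show ?thesis using Suc.IH[of t] Suc by simp
  qed
qed

text \<open>Programs are the pairs (s, j) coded as 2^s (2j + 1) - 1: unlike the Cantor pairing, this
  costs only s bits more than j itself.\<close>

definition odd_exp :: "nat \<Rightarrow> nat" where
  "odd_exp x = (LEAST s. \<exists>j<Suc x. Suc x = 2 ^ s * Suc (2 * j))"

definition odd_index :: "nat \<Rightarrow> nat" where
  "odd_index x = (LEAST j. Suc x = 2 ^ odd_exp x * Suc (2 * j))"

lemma odd_exp_index:
  assumes "Suc x = 2 ^ s * Suc (2 * j)"
  shows "odd_exp x = s" "odd_index x = j"
proof -
  have "\<exists>j<Suc x. Suc x = 2 ^ s * Suc (2 * j)" using assms odd_decomposition_bound by blast
  then show exp: "odd_exp x = s"
    unfolding odd_exp_def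
  proof (rule Least_equality)
    show "s \<le> s'" if "\<exists>j<Suc x. Suc x = 2 ^ s' * Suc (2 * j)" for s'
      using that assms odd_decomposition_unique[of s j s'] by auto
  qed
  show "odd_index x = j"
    unfolding odd_index_def exp
  proof (rule Least_equality)
    show "Suc x = 2 ^ s * Suc (2 * j)" by (rule assms)
    show "j \<le> i" if "Suc x = 2 ^ s * Suc (2 * i)" for i
      using that assms odd_decomposition_unique[of s j s i] by simp
  qed
qed

lemma computable_nat_odd_exp: "computable_nat odd_exp"
  unfolding odd_exp_def
proof (intro computable_intros)
  fix x
  obtain s j where sj: "Suc x = 2 ^ s * Suc (2 * j)" using odd_decomposition by blast
  then show "\<exists>s. \<exists>j<Suc x. Suc x = 2 ^ s * Suc (2 * j)" using odd_decomposition_bound by blast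
qed

lemma computable_nat_odd_index: "computable_nat odd_index"
  unfolding odd_index_def
proof (intro computable_intros computable_nat_comp[OF computable_nat_odd_exp])
  show "\<exists>j. Suc x = 2 ^ odd_exp x * Suc (2 * j)" for x
    using odd_decomposition odd_exp_index(1) by metis
qed

section \<open>Strings and plain complexity\<close>

definition str_decode :: "nat \<Rightarrow> bool list" where
  "str_decode = inv str_encode"

lemma str_decode_encode [simp]: "str_decode (str_encode \<sigma>) = \<sigma>"
  by (simp add: str_decode_def inj_str_encode)

lemma str_encode_decode [simp]: "str_encode (str_decode x) = x"
  by (simp add: str_decode_def surj_str_encode surj_f_inv_f)

text \<open>The codes of the strings of length m lie between 2^m - 1 and 2^(m+1) - 2.\<close>

lemma str_encode_bounds: "2 ^ length \<sigma> \<le> Suc (str_encode \<sigma>)" "Suc (str_encode \<sigma>) < 2 ^ Suc (length \<sigma>)"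
  by (induction \<sigma>) auto

lemma length_less_iff_str_encode: "length \<sigma> < l \<longleftrightarrow> Suc (str_encode \<sigma>) < 2 ^ l"
proof
  assume "length \<sigma> < l"
  then have "(2::nat) ^ Suc (length \<sigma>) \<le> 2 ^ l" by (intro power_increasing) auto
  then show "Suc (str_encode \<sigma>) < 2 ^ l" using str_encode_bounds(2)[of \<sigma>] by linarith
next
  assume "Suc (str_encode \<sigma>) < 2 ^ l"
  then have "(2::nat) ^ length \<sigma> < 2 ^ l" using str_encode_bounds(1)[of \<sigma>] by linarith
  then show "length \<sigma> < l" by simp
qed

text \<open>Turns a count of strings into a bounded sum over their codes, to which the closure rules
  for computable functions apply.\<close>

lemma sum_strings_of_length:
  "(\<Sum>y<2 ^ m. of_bool (P (2 ^ m - 1 + y))) = card {\<sigma>. length \<sigma> = m \<and> P (str_encode \<sigma>)}"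
proof -
  have "bij_betw (\<lambda>\<sigma>. Suc (str_encode \<sigma>) - 2 ^ m)
      {\<sigma>. length \<sigma> = m \<and> P (str_encode \<sigma>)} {y \<in> {..<2 ^ m}. P (2 ^ m - 1 + y)}"
  proof (rule bij_betw_byWitness[where f' = "\<lambda>y. str_decode (2 ^ m - 1 + y)"])
    have *: "2 ^ m - 1 + (Suc (str_encode \<sigma>) - 2 ^ m) = str_encode \<sigma>"
        "Suc (str_encode \<sigma>) - 2 ^ m < 2 ^ m" if "length \<sigma> = m" for \<sigma>
      using str_encode_bounds[of \<sigma>] that by auto
    show "\<forall>\<sigma>\<in>{\<sigma>. length \<sigma> = m \<and> P (str_encode \<sigma>)}.
        str_decode (2 ^ m - 1 + (Suc (str_encode \<sigma>) - 2 ^ m)) = \<sigma>"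
      using * by auto
    show "\<forall>y\<in>{y \<in> {..<2 ^ m}. P (2 ^ m - 1 + y)}.
        Suc (str_encode (str_decode (2 ^ m - 1 + y))) - 2 ^ m = y"
      by (auto simp flip: One_nat_def)
    show "(\<lambda>\<sigma>. Suc (str_encode \<sigma>) - 2 ^ m) ` {\<sigma>. length \<sigma> = m \<and> P (str_encode \<sigma>)}
        \<subseteq> {y \<in> {..<2 ^ m}. P (2 ^ m - 1 + y)}"
      using * by auto
    have "length (str_decode (2 ^ m - 1 + y)) = m" if "y < 2 ^ m" for y
      using length_less_iff_str_encode[of "str_decode (2 ^ m - 1 + y)" m]
        length_less_iff_str_encode[of "str_decode (2 ^ m - 1 + y)" "Suc m"] that by auto
    then show "(\<lambda>y. str_decode (2 ^ m - 1 + y)) ` {y \<in> {..<2 ^ m}. P (2 ^ m - 1 + y)}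
        \<subseteq> {\<sigma>. length \<sigma> = m \<and> P (str_encode \<sigma>)}"
      by auto
  qed
  then have "card {\<sigma>. length \<sigma> = m \<and> P (str_encode \<sigma>)} = card {y \<in> {..<2 ^ m}. P (2 ^ m - 1 + y)}"
    by (rule bij_betw_same_card)
  then show ?thesis by (simp add: sum.If_cases of_bool_def Collect_conj_eq lessThan_def)
qed

lemma computable_str_encoded:
  assumes "computable_str \<Gamma>"
  shows "computable_nat (\<lambda>x. str_encode (\<Gamma> (str_decode x)))"
proof -
  obtain g where g: "partrec g" "\<And>p. g (str_encode p) = Some (str_encode (\<Gamma> p))"
    using assms by (auto simp: computable_str_def partial_computable_def)
  have "g = (\<lambda>x. Some (str_encode (\<Gamma> (str_decode x))))"
    using g(2)[of "str_decode x" for x] by (intro ext) simp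
  with g(1) show ?thesis by (simp add: computable_nat_def)
qed

text \<open>Optimality compared with the identity machine gives every string a program, so the
  \<open>LEAST\<close> is attained.\<close>

lemma plain_complexity_witness:
  assumes "optimal_machine U"
  obtains p where "U p = Some \<sigma>" "length p = plain_complexity U \<sigma>"
proof -
  have "partrec (\<lambda>n. Some n)" using computable_nat_ident by (simp add: computable_nat_def)
  then have "partial_computable Some" unfolding partial_computable_def by (intro exI[of _ Some]) auto
  then have "\<exists>q. U q = Some \<sigma>" using assms unfolding optimal_machine_def by blast
  then have "\<exists>l p. U p = Some \<sigma> \<and> length p = l" by blast
  then have "\<exists>p. U p = Some \<sigma> \<and> length p = plain_complexity U \<sigma>"
    unfolding plain_complexity_def by (rule LeastI_ex)
  with that show ?thesis by blast
qed

lemma plain_complexity_le: "U p = Some \<sigma> \<Longrightarrow> plain_complexity U \<sigma> \<le> length p"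
  unfolding plain_complexity_def by (rule Least_le) blast

text \<open>Distinct strings have distinct shortest programs, and programs shorter than
  \<open>l\<close> have codes below 2^l.\<close>

lemma card_low_complexity:
  assumes "optimal_machine U"
  shows "finite {\<sigma>. plain_complexity U \<sigma> < l}" "card {\<sigma>. plain_complexity U \<sigma> < l} \<le> 2 ^ l"
proof -
  let ?S = "{\<sigma>. plain_complexity U \<sigma> < l}"
  have "\<exists>p. U p = Some \<sigma> \<and> length p = plain_complexity U \<sigma>" for \<sigma>
    using plain_complexity_witness[OF assms] by blast
  then obtain prog where prog: "\<And>\<sigma>. U (prog \<sigma>) = Some \<sigma>"
      "\<And>\<sigma>. length (prog \<sigma>) = plain_complexity U \<sigma>"
    by metis
  have inj: "inj_on (\<lambda>\<sigma>. str_encode (prog \<sigma>)) ?S"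
    by (rule inj_onI) (metis option.inject prog(1) str_decode_encode)
  have sub: "(\<lambda>\<sigma>. str_encode (prog \<sigma>)) ` ?S \<subseteq> {..<2 ^ l}"
    using length_less_iff_str_encode[of "prog \<sigma>" l for \<sigma>] by (auto simp: prog(2) dest: Suc_lessD)
  show "finite ?S" using inj sub finite_lessThan by (rule inj_on_finite)
  show "card ?S \<le> 2 ^ l" using card_inj_on_le[OF inj sub] by simp
qed

text \<open>The program codes the pair (s, j). The machine recovers both, searches for the least
  witness \<open>z\<close> for \<open>s\<close> and prints entry \<open>j\<close> of the sequence
  coded by the second component of \<open>z\<close>; it diverges if there is no witness.\<close>

lemma search_machine:
  assumes "decidable_nat (\<lambda>e. P (pfst e) (psnd e))"
  shows "\<exists>M. partial_computable M \<and>
    (\<forall>s j l. (\<exists>z. P s z) \<longrightarrow> j < 2 ^ l \<longrightarrow>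
      (\<exists>p. M p = Some (str_decode (code_nth (psnd (LEAST z. P s z)) j)) \<and> length p \<le> s + l))"
proof -
  define S where "S = mu_search (\<lambda>z. Some (of_bool (\<not> P (pfst z) (psnd z)) :: nat))"
  define out where "out e = code_nth (psnd (pfst e)) (odd_index (psnd e))" for e
  define V where "V x = Option.bind (S (odd_exp x))
      (\<lambda>z. Some (code_nth (psnd z) (odd_index x)))" for x
  define M where "M p = map_option str_decode (V (str_encode p))" for p
  have partrec_S: "partrec S"
    using decidable_nat_not[OF assms] unfolding S_def decidable_nat_def computable_nat_def
    by (rule partrec.mu)
  have "computable_nat out"
    unfolding out_def by (intro computable_intros computable_nat_comp[OF computable_nat_odd_index])
  \<comment> \<open>The nested form of \<open>V\<close> that matches the rules for composition and
    pairing.\<close>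
  then have "partrec (\<lambda>x. Option.bind (Option.bind (Option.bind (Some (odd_exp x)) S)
      (\<lambda>a. Option.bind (Some x) (\<lambda>b. Some (prod_encode (a, b))))) (\<lambda>e. Some (out e)))"
    using computable_nat_odd_exp computable_nat_ident partrec_S unfolding computable_nat_def
    by (intro partrec.comp[where f = "\<lambda>e. Some (out e)"] partrec.pair partrec.comp[where f = S])
  moreover have "(\<lambda>x. Option.bind (Option.bind (Option.bind (Some (odd_exp x)) S)
      (\<lambda>a. Option.bind (Some x) (\<lambda>b. Some (prod_encode (a, b))))) (\<lambda>e. Some (out e))) = V"
    by (simp add: V_def out_def bind_assoc fun_eq_iff)
  ultimately have "partrec V" by simp
  then have "partial_computable M"
    unfolding partial_computable_def M_def
    by (intro exI[of _ V]) (auto simp: option.map_comp o_def option.map_ident)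
  moreover have "\<exists>p. M p = Some (str_decode (code_nth (psnd (LEAST z. P s z)) j)) \<and> length p \<le> s + l"
    if "\<exists>z. P s z" and j: "j < 2 ^ l" for s j l
  proof -
    define x where "x = 2 ^ s * Suc (2 * j) - 1"
    have x: "Suc x = 2 ^ s * Suc (2 * j)" by (simp add: x_def)
    have "S s = Some (LEAST z. P s z)"
      unfolding S_def using that(1) by (rule mu_search_total)
    then have "M (str_decode x) = Some (str_decode (code_nth (psnd (LEAST z. P s z)) j))"
      by (simp add: M_def V_def odd_exp_index[OF x])
    \<comment> \<open>Since 2j + 1 < 2^(l+1), the number \<open>Suc x\<close> is below 2^(s+l+1),
      and the program has at most s + l bits.\<close>
    moreover have "length (str_decode x) < Suc (s + l)"
    proof -
      have "Suc (2 * j) < 2 ^ Suc l" using j by simp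
      then have "2 ^ s * Suc (2 * j) < 2 ^ s * 2 ^ Suc l" by (intro mult_strict_left_mono) auto
      then show ?thesis unfolding length_less_iff_str_encode by (simp add: x power_add)
    qed
    ultimately show ?thesis by (intro exI[of _ "str_decode x"]) simp
  qed
  ultimately show ?thesis by blast
qed

section \<open>Popular values of several functions on a finite set\<close>

lemma surj_onto_finite:
  assumes "finite B" "card B \<le> T"
  shows "\<exists>h. B \<subseteq> h ` {..<T::nat}"
proof -
  obtain g where g: "bij_betw g {0..<card B} B"
    using ex_bij_betw_nat_finite[OF assms(1)] by blast
  then have "B \<subseteq> g ` {..<T}" using assms(2) by (force simp: bij_betw_def)
  then show ?thesis by blast
qed

text \<open>Discarding an element of least weight never lowers the average weight; this is repeated
  until \<open>t\<close> elements remain. The comparison of averages is stated without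
  division.\<close>

lemma heavy_subset:
  fixes w :: "'a \<Rightarrow> nat"
  assumes "finite V" "t \<le> card V"
  shows "\<exists>S\<subseteq>V. card S = t \<and> t * sum w V \<le> card V * sum w S"
  using assms
proof (induction "card V - t" arbitrary: V)
  case 0
  then show ?case by (intro exI[of _ V]) auto
next
  case (Suc j)
  then have "V \<noteq> {}" by auto
  obtain v where v: "v \<in> V" "\<And>u. u \<in> V \<Longrightarrow> w v \<le> w u"
    using ex_is_arg_min_if_finite[OF Suc.prems(1) \<open>V \<noteq> {}\<close>, of w] by (auto simp: is_arg_min_linorder)
  define c where "c = card (V - {v})"
  have cV: "card V = Suc c"
    unfolding c_def by (rule card.remove[OF Suc.prems(1) v(1)])
  have sumV: "sum w V = w v + sum w (V - {v})"
    by (rule sum.remove[OF Suc.prems(1) v(1)])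
  have "c * w v \<le> sum w (V - {v})"
    unfolding c_def using v(2) by (intro sum_bounded_below[of _ "w v", simplified]) auto
  then have drop: "c * sum w V \<le> Suc c * sum w (V - {v})"
    by (simp add: sumV algebra_simps)
  have "j = card (V - {v}) - t" "finite (V - {v})" "t \<le> card (V - {v})"
    using Suc.hyps(2) Suc.prems cV unfolding c_def[symmetric] by simp_all
  from Suc.hyps(1)[OF this] obtain S
    where S: "S \<subseteq> V - {v}" "card S = t" "t * sum w (V - {v}) \<le> c * sum w S"
    unfolding c_def by blast
  have "t * sum w V \<le> card V * sum w S"
  \<comment> \<open>The chain below is cancelled by \<open>c\<close>, so the case of a singleton
    \<open>V\<close> stands apart.\<close>
  proof (cases "c = 0")
    case True
    then have "t = 0" using Suc.hyps(2) cV by linarith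
    then show ?thesis by simp
  next
    case False
    have "c * (t * sum w V) = t * (c * sum w V)" by simp
    also have "\<dots> \<le> t * (Suc c * sum w (V - {v}))" using drop by (rule mult_le_mono2)
    also have "\<dots> = Suc c * (t * sum w (V - {v}))" by (rule mult.left_commute)
    also have "\<dots> \<le> Suc c * (c * sum w S)" using S(3) by (rule mult_le_mono2)
    also have "\<dots> = c * (card V * sum w S)" unfolding cV by (rule mult.left_commute)
    finally have "c * (t * sum w V) \<le> c * (card V * sum w S)" .
    then show ?thesis using False by simp
  qed
  with S show ?case by blast
qed

lemma card_eq_sum_fibres:
  assumes "finite E" "finite S"
  shows "card {e \<in> E. g e \<in> S} = (\<Sum>v\<in>S. card {e \<in> E. g e = v})"
proof -
  have "{e \<in> E. g e \<in> S} = (\<Union>v\<in>S. {e \<in> E. g e = v})" by auto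
  then show ?thesis using assms by (simp, subst card_UN_disjoint) auto
qed

text \<open>The fibres over the \<open>t\<close> most popular values of \<open>g\<close> are kept:
  \<open>heavy_subset\<close> applied to fibre sizes. If fewer than \<open>t\<close> values occur,
  \<open>E\<close> itself serves.\<close>

lemma heavy_fibres:
  assumes "finite E" "card (g ` E) \<le> N" "t \<le> N"
  shows "\<exists>E'\<subseteq>E. card (g ` E') \<le> t \<and> t * card E \<le> N * card E'"
proof (cases "t \<le> card (g ` E)")
  case False
  then show ?thesis using assms by (intro exI[of _ E]) (auto intro: mult_le_mono1)
next
  case True
  define w where "w v = card {e \<in> E. g e = v}" for v
  obtain S where S: "S \<subseteq> g ` E" "card S = t" "t * sum w (g ` E) \<le> card (g ` E) * sum w S"
    using heavy_subset[OF _ True] assms(1) by blast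
  have fin: "finite S" using S(1) assms(1) finite_subset by blast
  let ?E = "{e \<in> E. g e \<in> S}"
  have "{e \<in> E. g e \<in> g ` E} = E" by auto
  then have "t * card E = t * sum w (g ` E)"
    using card_eq_sum_fibres[of E "g ` E" g] assms(1) by (simp add: w_def)
  also have "\<dots> \<le> card (g ` E) * card ?E"
    using S(3) card_eq_sum_fibres[OF assms(1) fin, of g] by (simp add: w_def)
  also have "\<dots> \<le> N * card ?E" using assms(2) by (rule mult_le_mono1)
  finally have "t * card E \<le> N * card ?E" .
  moreover have "card (g ` ?E) \<le> t"
    using card_mono[OF fin, of "g ` ?E"] S(2) by auto
  ultimately show ?thesis by (intro exI[of _ ?E]) auto
qed

text \<open>The functions are treated one after another, each keeping at least the fraction t/N.
  Bounds obtained earlier persist because images of subsets only shrink.\<close>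

lemma heavy_fibres_family:
  fixes g :: "'i \<Rightarrow> 'e \<Rightarrow> 'v"
  assumes "finite I" "finite E" "\<And>i. i \<in> I \<Longrightarrow> card (g i ` E) \<le> N" "t \<le> N"
  shows "\<exists>E'\<subseteq>E. (\<forall>i\<in>I. card (g i ` E') \<le> t) \<and> t ^ card I * card E \<le> N ^ card I * card E'"
  using assms(1,3)
proof (induction I)
  case empty
  then show ?case by auto
next
  case (insert i I)
  then obtain F where F: "F \<subseteq> E" "\<forall>j\<in>I. card (g j ` F) \<le> t"
      "t ^ card I * card E \<le> N ^ card I * card F"
    by (metis insertCI)
  have finF: "finite F" using F(1) assms(2) finite_subset by blast
  have "card (g i ` F) \<le> N"
    using insert.prems[of i] card_mono[of "g i ` E" "g i ` F"] assms(2) F(1)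
    by (meson finite_imageI image_mono insertI1 order_trans)
  then obtain E' where E': "E' \<subseteq> F" "card (g i ` E') \<le> t" "t * card F \<le> N * card E'"
    using heavy_fibres[OF finF _ assms(4)] by blast
  have "card (g j ` E') \<le> t" if "j \<in> I" for j
    using that F(2) card_mono[of "g j ` F" "g j ` E'"] finF E'(1)
    by (meson finite_imageI image_mono order_trans)
  moreover have "t ^ card (insert i I) * card E \<le> N ^ card (insert i I) * card E'"
  proof -
    have "t * (t ^ card I * card E) \<le> t * (N ^ card I * card F)" using F(3) by (rule mult_le_mono2)
    also have "\<dots> = N ^ card I * (t * card F)" by simp
    also have "\<dots> \<le> N ^ card I * (N * card E')" using E'(3) by (rule mult_le_mono2)
    finally show ?thesis using insert.hyps by (simp add: algebra_simps)
  qed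
  ultimately show ?case using E' F(1) by (intro exI[of _ E']) auto
qed

section \<open>Gaining a constant factor by the pigeonhole principle\<close>

lemma finite_colouring:
  assumes "finite X" "card X \<le> u * c"
  obtains \<kappa> :: "'a \<Rightarrow> nat" where "\<kappa> ` X \<subseteq> {..<c}" "\<And>j. card {x \<in> X. \<kappa> x = j} \<le> u"
proof (cases "u = 0")
  case True
  then have "X = {}" using assms by simp
  then show ?thesis using that[of "\<lambda>_. 0"] by simp
next
  case False
  obtain h where h: "bij_betw h X {0..<card X}" using ex_bij_betw_finite_nat[OF assms(1)] by blast
  \<comment> \<open>The colour classes are blocks of \<open>u\<close> consecutive indices in an
    enumeration of \<open>X\<close>.\<close>
  have "h x div u < c" if "x \<in> X" for x
  proof -
    have "h x < u * c" using bij_betwE[OF h] that assms(2) by force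
    then show ?thesis using False by (simp add: div_less_iff_less_mult mult.commute)
  qed
  moreover have "card {x \<in> X. h x div u = j} \<le> u" for j
  proof -
    have "h y \<in> {u * j..<u * j + u}" if "h y div u = j" for y
      using that False dividend_less_times_div[of u "h y"] by auto
    then have "h ` {x \<in> X. h x div u = j} \<subseteq> {u * j..<u * j + u}" by blast
    then have "card (h ` {x \<in> X. h x div u = j}) \<le> u"
      using card_mono[of "{u * j..<u * j + u}"] by fastforce
    moreover have "inj_on h {x \<in> X. h x div u = j}"
      using h by (auto simp: bij_betw_def intro: inj_on_subset)
    ultimately show ?thesis by (simp add: card_image)
  qed
  ultimately show ?thesis using that[of "\<lambda>x. h x div u"] by auto
qed

text \<open>With t = M u, popularity alone would leave only O(t) elements; the blocks of size
  \<open>u\<close> yield M t. The factor 2 in the density allows for the values of \<open>h\<close>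
  taken fewer than \<open>M\<close> times, and the lower bound on \<open>N\<close> pays for the case
  of few popular values.\<close>

lemma dense_pair:
  fixes g :: "'e \<Rightarrow> 'v" and h :: "'e \<Rightarrow> 'w"
  assumes fin: "finite E"
    and g: "card (g ` E) \<le> L * (M * u)" and h: "card (h ` E) \<le> N"
    and E: "2 * M * N \<le> card E"
    and N: "2 ^ (L * M) * L * (M * u) \<le> N" and "0 < L"
  shows "\<exists>E'\<subseteq>E. card (g ` E') \<le> M * u \<and> card (h ` E') \<le> M * u \<and> M * (M * u) \<le> card E'"
proof -
  define t where "t = M * u"
  define C :: nat where "C = 2 ^ (L * M)"
  define F where "F y = {e \<in> E. h e = y}" for y
  \<comment> \<open>\<open>Y\<close> holds the values of \<open>h\<close> taken at least
    \<open>M\<close> times; \<open>C\<close> is the number of sets of blocks.\<close>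
  define Y where "Y = {y \<in> h ` E. M \<le> card (F y)}"
  have finY: "finite Y" using fin by (simp add: Y_def)
  show ?thesis
  proof (cases "card Y \<le> C * t")
    case True
    define E1 where "E1 = {e \<in> E. h e \<in> Y}"
    have fin1: "finite E1" using fin by (simp add: E1_def)
    \<comment> \<open>Values outside \<open>Y\<close> account for at most M N elements, so at least
      M N elements lie over \<open>Y\<close>.\<close>
    have "card {e \<in> E. h e \<in> h ` E - Y} = (\<Sum>y\<in>h ` E - Y. card (F y))"
      unfolding F_def using fin by (intro card_eq_sum_fibres) auto
    also have "\<dots> \<le> card (h ` E - Y) * M"
      by (intro sum_bounded_above[of _ _ M, simplified]) (auto simp: Y_def)
    also have "\<dots> \<le> N * M"
      using h card_mono[of "h ` E" "h ` E - Y"] fin by (intro mult_le_mono1) auto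
    finally have "card {e \<in> E. h e \<in> h ` E - Y} \<le> N * M" .
    moreover have "card E \<le> card E1 + card {e \<in> E. h e \<in> h ` E - Y}"
      by (rule order_trans[OF card_mono card_Un_le]) (use fin in \<open>auto simp: E1_def\<close>)
    ultimately have E1: "M * N \<le> card E1" using E by (simp add: algebra_simps)
    have "card (h ` E1) \<le> C * t"
      using True card_mono[OF finY, of "h ` E1"] by (force simp: E1_def)
    then obtain E2 where E2: "E2 \<subseteq> E1" "card (h ` E2) \<le> t" "t * card E1 \<le> C * t * card E2"
      using heavy_fibres[OF fin1, of h "C * t" t] by (auto simp: C_def)
    have fin2: "finite E2" using E2(1) fin1 finite_subset by blast
    have "card (g ` E2) \<le> L * t"
      using g E2(1) card_mono[of "g ` E" "g ` E2"] fin by (force simp: E1_def t_def)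
    then obtain E3 where E3: "E3 \<subseteq> E2" "card (g ` E3) \<le> t" "t * card E2 \<le> L * t * card E3"
      using heavy_fibres[OF fin2, of g "L * t" t] \<open>0 < L\<close> by auto
    have h3: "card (h ` E3) \<le> t"
      using E2(2) E3(1) card_mono[of "h ` E2" "h ` E3"] fin2 by force
    have "M * t \<le> card E3"
    proof (cases "t = 0")
      case False
      \<comment> \<open>The two restrictions cost the factors \<open>C\<close> and \<open>L\<close>,
        which the lower bound on \<open>N\<close> compensates.\<close>
      have "C * L * (M * t) \<le> M * N" using N by (simp add: C_def t_def mult.left_commute)
      also have "\<dots> \<le> card E1" by (rule E1)
      also have "\<dots> \<le> C * card E2" using E2(3) False by simp
      also have "\<dots> \<le> C * (L * card E3)" using E3(3) False by simp
      finally have "C * L * (M * t) \<le> C * L * card E3" by simp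
      then show ?thesis using \<open>0 < L\<close> by (simp add: C_def)
    qed simp
    then show ?thesis using E2 E3 h3 unfolding t_def E1_def by (intro exI[of _ E3]) auto
  next
    case False
    obtain \<kappa> where \<kappa>: "\<kappa> ` g ` E \<subseteq> {..<L * M}" "\<And>j. card {x \<in> g ` E. \<kappa> x = j} \<le> u"
      using finite_colouring[of "g ` E" u "L * M"] g fin by (auto simp: ac_simps)
    \<comment> \<open>Any \<open>M\<close> elements of a fibre meet at most \<open>M\<close>
      blocks.\<close>
    have "\<exists>S. S \<subseteq> {..<L * M} \<and> card S \<le> M \<and> M \<le> card {e \<in> F y. \<kappa> (g e) \<in> S}" if "y \<in> Y" for y
    proof -
      have finF: "finite (F y)" using fin by (simp add: F_def)
      have "M \<le> card (F y)" using that by (simp add: Y_def)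
      then obtain D where D: "D \<subseteq> F y" "card D = M" "finite D"
        by (rule obtain_subset_with_card_n)
      have sub: "D \<subseteq> {e \<in> F y. \<kappa> (g e) \<in> (\<lambda>e. \<kappa> (g e)) ` D}" using D by auto
      have "M \<le> card {e \<in> F y. \<kappa> (g e) \<in> (\<lambda>e. \<kappa> (g e)) ` D}"
        using card_mono[OF _ sub] finF D(2) by simp
      moreover have "(\<lambda>e. \<kappa> (g e)) ` D \<subseteq> {..<L * M}" using \<kappa>(1) D(1) by (auto simp: F_def)
      moreover have "card ((\<lambda>e. \<kappa> (g e)) ` D) \<le> M" using D card_image_le by blast
      ultimately show ?thesis by blast
    qed
    then obtain S where S: "\<And>y. y \<in> Y \<Longrightarrow> S y \<subseteq> {..<L * M}" "\<And>y. y \<in> Y \<Longrightarrow> card (S y) \<le> M"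
        "\<And>y. y \<in> Y \<Longrightarrow> M \<le> card {e \<in> F y. \<kappa> (g e) \<in> S y}"
      by metis
    have cardSY: "card (S ` Y) \<le> C"
      using card_mono[of "Pow {..<L * M}" "S ` Y"] S(1) by (auto simp: card_Pow C_def)
    \<comment> \<open>More than C t values \<open>y\<close> share at most \<open>C\<close> sets of
      blocks.\<close>
    have "\<exists>T\<in>S ` Y. t \<le> card {y \<in> Y. S y = T}"
    proof (rule ccontr)
      assume *: "\<not> ?thesis"
      have "card Y = card {y \<in> Y. S y \<in> S ` Y}" by (rule arg_cong[of _ _ card]) auto
      also have "\<dots> = (\<Sum>T\<in>S ` Y. card {y \<in> Y. S y = T})"
        using finY by (intro card_eq_sum_fibres) auto
      also have "\<dots> \<le> card (S ` Y) * t"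
        using * by (intro sum_bounded_above[of _ _ t, simplified]) (auto simp: not_le less_imp_le)
      also have "\<dots> \<le> C * t" using cardSY by (rule mult_le_mono1)
      finally show False using False by simp
    qed
    then obtain T where T: "T \<in> S ` Y" "t \<le> card {y \<in> Y. S y = T}" by blast
    obtain Z where Z: "Z \<subseteq> {y \<in> Y. S y = T}" "card Z = t" "finite Z"
      using obtain_subset_with_card_n[OF T(2)] by blast
    have T': "T \<subseteq> {..<L * M}" "card T \<le> M" using T(1) S(1,2) by auto
    then have finT: "finite T" using finite_subset by blast
    \<comment> \<open>The blocks in \<open>T\<close> contain at most M u = t values of
      \<open>g\<close>, while each of the \<open>t\<close> values in \<open>Z\<close> still carries
      at least \<open>M\<close> elements.\<close>
    define E1 where "E1 = {e \<in> E. h e \<in> Z \<and> \<kappa> (g e) \<in> T}"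
    have "card (g ` E1) \<le> card (\<Union>j\<in>T. {x \<in> g ` E. \<kappa> x = j})"
      using fin finT by (intro card_mono) (auto simp: E1_def)
    also have "\<dots> \<le> (\<Sum>j\<in>T. card {x \<in> g ` E. \<kappa> x = j})" using finT by (rule card_UN_le)
    also have "\<dots> \<le> card T * u" using \<kappa>(2) by (intro sum_bounded_above[of _ _ u, simplified])
    also have "\<dots> \<le> t" unfolding t_def using T'(2) by (rule mult_le_mono1)
    finally have g1: "card (g ` E1) \<le> t" .
    have h1: "card (h ` E1) \<le> t" using Z card_mono[of Z "h ` E1"] by (auto simp: E1_def)
    have "{e \<in> E1. h e \<in> Z} = E1" by (auto simp: E1_def)
    then have "card E1 = (\<Sum>y\<in>Z. card {e \<in> E1. h e = y})"
      using card_eq_sum_fibres[of E1 Z h] fin Z(3) by (simp add: E1_def)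
    also have "\<dots> \<ge> card Z * M"
    proof (intro sum_bounded_below[of _ M, simplified])
      fix y assume y: "y \<in> Z"
      then have "{e \<in> E1. h e = y} = {e \<in> F y. \<kappa> (g e) \<in> S y}" "y \<in> Y"
        using Z(1) by (auto simp: E1_def F_def)
      then show "M \<le> card {e \<in> E1. h e = y}" using S(3) by simp
    qed
    finally have "M * t \<le> card E1" using Z(2) by (simp add: mult.commute)
    then show ?thesis using g1 h1 unfolding t_def by (intro exI[of _ E1]) (auto simp: E1_def)
  qed
qed

lemma heavy_fibres_power:
  fixes g :: "'i \<Rightarrow> 'e \<Rightarrow> 'v"
  assumes "finite I" "finite E" "card E = 2 ^ m" "\<And>i. i \<in> I \<Longrightarrow> card (g i ` E) \<le> 2 ^ n"
    and "l \<le> n" "card I * n + b \<le> card I * l + m"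
  shows "\<exists>A\<subseteq>E. (\<forall>i\<in>I. card (g i ` A) \<le> 2 ^ l) \<and> 2 ^ b \<le> card A"
proof -
  obtain A where A: "A \<subseteq> E" "\<forall>i\<in>I. card (g i ` A) \<le> 2 ^ l"
      "(2 ^ l) ^ card I * card E \<le> (2 ^ n) ^ card I * card A"
    using heavy_fibres_family[of I E g "2 ^ n" "2 ^ l"] assms by auto
  have "(2::nat) ^ (card I * n) * 2 ^ b \<le> 2 ^ (card I * l + m)"
    using assms(6) by (simp flip: power_add)
  also have "\<dots> = (2 ^ l) ^ card I * card E"
    by (simp add: assms(3) power_add power_mult mult.commute[of "card I"])
  also have "\<dots> \<le> (2 ^ n) ^ card I * card A" by (rule A(3))
  also have "\<dots> = 2 ^ (card I * n) * card A"
    by (simp add: power_mult mult.commute[of "card I"])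
  finally have "2 ^ b \<le> card A" by simp
  with A show ?thesis by blast
qed

text \<open>\<open>dense_pair\<close> is used with L = 2^a, M = 2^\<mu> and u = 2^(l - \<mu>).
  Hypothesis \<open>n\<close> is its lower bound on \<open>N\<close>; hypothesis \<open>m\<close>
  provides the density that remains after the other restrictions.\<close>

lemma boosted_subset:
  fixes g :: "nat \<Rightarrow> 'e \<Rightarrow> 'v"
  assumes k: "2 \<le> k" and fin: "finite E" and E: "card E = 2 ^ m"
    and g: "\<And>i. i \<in> {1..k} \<Longrightarrow> card (g i ` E) \<le> 2 ^ n"
    and "\<mu> \<le> l" and n: "a + l + 2 ^ (a + \<mu>) \<le> n"
    and m: "(k - 1) * n + (n + \<mu> + 1) \<le> (k - 1) * l + (m + a)"
  shows "\<exists>A\<subseteq>E. (\<forall>i\<in>{1..k}. card (g i ` A) \<le> 2 ^ l) \<and> 2 ^ (\<mu> + l) \<le> card A"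
proof -
  obtain k' where k': "k = Suc (Suc k')" using k by (metis add_2_eq_Suc le_Suc_ex)
  obtain E1 where E1: "E1 \<subseteq> E" "\<forall>i\<in>{3..k}. card (g i ` E1) \<le> 2 ^ l"
      "(2 ^ l) ^ k' * card E \<le> (2 ^ n) ^ k' * card E1"
    using heavy_fibres_family[of "{3..k}" E g "2 ^ n" "2 ^ l"] fin g n by (auto simp: k')
  have mono: "card (g i ` B) \<le> card (g i ` C)" if "B \<subseteq> C" "C \<subseteq> E" for i B C
    using that fin by (meson card_mono finite_imageI finite_subset image_mono)
  have "card (g 1 ` E1) \<le> 2 ^ n" using mono[OF E1(1), of 1] g[of 1] k by simp
  then obtain E2 where E2: "E2 \<subseteq> E1" "card (g 1 ` E2) \<le> 2 ^ (a + l)"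
      "2 ^ (a + l) * card E1 \<le> 2 ^ n * card E2"
    using heavy_fibres[of E1 "g 1" "2 ^ n" "2 ^ (a + l)"] E1(1) fin n
    by (auto intro: finite_subset)
  have E2E: "E2 \<subseteq> E" using E1(1) E2(1) by blast
  have card2: "card (g 2 ` E2) \<le> 2 ^ n" using mono[OF E2E, of 2] g[of 2] k by simp
  \<comment> \<open>Here \<open>Suc k'\<close> is k - 1, the number of functions restricted so far,
    and the chain bounds \<open>card E2\<close> below by 2 M 2^n.\<close>
  have "(2::nat) ^ (Suc k' * n) * (2 * 2 ^ \<mu> * 2 ^ n) = 2 ^ (Suc k' * n + (n + \<mu> + 1))"
    by (simp add: power_add)
  also have "\<dots> \<le> 2 ^ (Suc k' * l + (m + a))"
    using m by (intro power_increasing) (simp_all add: k')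
  also have "\<dots> = 2 ^ (a + l) * ((2 ^ l) ^ k' * card E)"
    by (simp add: E power_add power_mult[symmetric] mult.commute)
  also have "\<dots> \<le> 2 ^ (a + l) * ((2 ^ n) ^ k' * card E1)"
    using E1(3) by (rule mult_le_mono2)
  also have "\<dots> = (2 ^ n) ^ k' * (2 ^ (a + l) * card E1)" by simp
  also have "\<dots> \<le> (2 ^ n) ^ k' * (2 ^ n * card E2)" using E2(3) by (rule mult_le_mono2)
  also have "\<dots> = 2 ^ (Suc k' * n) * card E2"
    by (simp add: power_add power_mult[symmetric] mult.commute)
  finally have dense: "2 * 2 ^ \<mu> * 2 ^ n \<le> card E2" by simp
  have t: "(2::nat) ^ \<mu> * 2 ^ (l - \<mu>) = 2 ^ l" using \<open>\<mu> \<le> l\<close> by (simp flip: power_add)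
  have "(2::nat) ^ (2 ^ a * 2 ^ \<mu>) * 2 ^ a * 2 ^ l = 2 ^ (a + l + 2 ^ (a + \<mu>))"
    by (simp add: power_add)
  also have "\<dots> \<le> 2 ^ n" using n by (intro power_increasing) simp_all
  finally have wide: "(2::nat) ^ (2 ^ a * 2 ^ \<mu>) * 2 ^ a * 2 ^ l \<le> 2 ^ n" .
  obtain A where A: "A \<subseteq> E2" "card (g 1 ` A) \<le> 2 ^ l" "card (g 2 ` A) \<le> 2 ^ l"
      "2 ^ \<mu> * 2 ^ l \<le> card A"
    using dense_pair[of E2 "g 1" "2 ^ a" "2 ^ \<mu>" "2 ^ (l - \<mu>)" "g 2" "2 ^ n", unfolded t,
        OF finite_subset[OF E2E fin] _ card2 dense wide] E2(2)
    by (auto simp: power_add)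
  have "card (g i ` A) \<le> 2 ^ l" if i: "i \<in> {1..k}" for i
  proof -
    consider "i = 1" | "i = 2" | "i \<in> {3..k}" using i by fastforce
    then show ?thesis
    proof cases
      case 3
      have "card (g i ` A) \<le> card (g i ` E1)" using mono[of A E1 i] A(1) E2(1) E1(1) by blast
      then show ?thesis using E1(2) 3 order_trans by blast
    qed (use A in auto)
  qed
  then show ?thesis using A(1,4) E2E by (intro exI[of _ A]) (auto simp: power_add)
qed

section \<open>Rich sets of strings with small images\<close>

text \<open>The gap of k + 3s between \<open>r' n\<close> and \<open>l\<close> lets the union of the
  \<open>k\<close> images fit into 2^(r' n - 3s) values, since k 2^l \<le> 2^(k+l).\<close>

lemma rich_set_exists:
  fixes f :: "nat \<Rightarrow> nat" and \<Gamma> :: "nat \<Rightarrow> bool list \<Rightarrow> bool list" and \<alpha> \<beta> :: real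
  assumes k: "2 \<le> k" and \<alpha>: "0 < \<alpha>" "\<alpha> < 1" and \<beta>: "0 < \<beta>" "\<beta> < 1"
    and \<beta>_eq: "\<beta> = real k * \<alpha> / (1 + (real k - 1) * \<alpha>)"
    and f: "inj f"
    and len: "\<And>n \<sigma> i. length \<sigma> = f n \<Longrightarrow> i \<in> {1..k} \<Longrightarrow> length (\<Gamma> i \<sigma>) = n"
    and r: "\<And>n. \<bar>real (r n) - \<alpha> * real n\<bar> \<le> 2" and r': "\<And>n. \<bar>real (r' n) - \<beta> * real n\<bar> \<le> 2"
  shows "\<exists>n l A. r' n = l + k + 3 * s \<and> A \<subseteq> {\<sigma>. length \<sigma> = f n} \<and>
    (\<forall>i\<in>{1..k}. card (\<Gamma> i ` A) \<le> 2 ^ l) \<and> 2 ^ (r (f n) + 2 * s) \<le> card A"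
proof -
  \<comment> \<open>The critical ratio of \<open>f n\<close> to \<open>n\<close>.\<close>
  define \<theta> where "\<theta> = real k / (1 + (real k - 1) * \<alpha>)"
  have "(real k - 1) * \<alpha> \<ge> 0" using k \<alpha> by simp
  then have pos: "1 + (real k - 1) * \<alpha> > 0" by linarith
  have \<theta>1: "\<beta> = \<alpha> * \<theta>" by (simp add: \<beta>_eq \<theta>_def)
  have \<theta>2: "(1 - \<alpha>) * \<theta> = real k * (1 - \<beta>)"
    using pos by (simp add: \<beta>_eq \<theta>_def field_simps)
  have \<theta>3: "1 + (real k - 1) * (1 - \<beta>) = \<theta>"
    using pos by (simp add: \<beta>_eq \<theta>_def field_simps)

  \<comment> \<open>\<open>c1\<close> bounds \<beta>n - l; \<open>c2\<close> and \<open>c3\<close>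
    are the margins with which the small and the large case succeed. In the critical case \<mu> is
    the missing exponent, and \<open>a\<close> makes up for the distance of m below
    \<theta>n.\<close>
  define c1 :: real where "c1 = 3 * s + k + 2"
  define c2 :: real where "c2 = c1 + 2 + 2 * s"
  define c3 :: real where "c3 = k * c1 + 2 + 2 * s"
  define \<mu> where "\<mu> = nat \<lceil>\<alpha> * (c3 / (1 - \<alpha>)) + c2\<rceil>"
  define a where "a = nat \<lceil>real \<mu> + 1 + (real k - 1) * c1 + c2 / \<alpha>\<rceil>"
  have \<mu>: "\<alpha> * (c3 / (1 - \<alpha>)) + c2 \<le> real \<mu>" unfolding \<mu>_def by (rule real_nat_ceiling_ge)
  have a: "real \<mu> + 1 + (real k - 1) * c1 + c2 / \<alpha> \<le> real a"
    unfolding a_def by (rule real_nat_ceiling_ge)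

  \<comment> \<open>\<open>n0\<close> ensures \<mu> \<le> l and leaves room for 2^(a + \<mu>) in
    \<open>boosted_subset\<close>; \<open>m0\<close> ensures that there are enough strings of length
    m.\<close>
  define n0 where "n0 = nat \<lceil>(c1 + real \<mu>) / \<beta>\<rceil> + nat \<lceil>(2 + real a + 2 ^ (a + \<mu>)) / (1 - \<beta>)\<rceil>"
  define m0 where "m0 = nat \<lceil>(2 * real s + 2) / (1 - \<alpha>)\<rceil>"
  \<comment> \<open>Injectivity makes \<open>f n\<close> small for finitely many \<open>n\<close>
    only, so \<open>n\<close> and \<open>f n\<close> can be large together.\<close>
  have "finite ({..<n0} \<union> f -` {..<m0})" using f by (simp add: finite_vimageI)
  then obtain n where "n \<notin> {..<n0} \<union> f -` {..<m0}" using ex_new_if_finite infinite_UNIV_nat by blast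
  then have n: "n0 \<le> n" and m: "m0 \<le> f n" by auto
  define m where "m = f n"
  have "(c1 + real \<mu>) / \<beta> \<le> real n" using n unfolding n0_def by linarith
  then have n1: "c1 + real \<mu> \<le> \<beta> * real n" using \<beta> by (simp add: field_simps)
  have "(2 + real a + 2 ^ (a + \<mu>)) / (1 - \<beta>) \<le> real n" using n unfolding n0_def by linarith
  then have n2: "2 + real a + 2 ^ (a + \<mu>) \<le> real n - \<beta> * real n"
    using \<beta> by (simp add: field_simps)
  have "(2 * real s + 2) / (1 - \<alpha>) \<le> real m" using m unfolding m0_def m_def by linarith
  then have m1: "2 * real s + 2 \<le> real m - \<alpha> * real m" using \<alpha> by (simp add: field_simps)

  define l where "l = r' n - (k + 3 * s)"
  \<comment> \<open>The subtraction defining \<open>l\<close> is not truncated.\<close>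
  have "real (k + 3 * s) \<le> real (r' n)" using r'[of n] n1 by (simp add: c1_def)
  then have r'_eq: "r' n = l + k + 3 * s" by (simp add: l_def)
  have l1: "\<beta> * real n - c1 \<le> real l" and l2: "real l \<le> \<beta> * real n + 2"
    using r'[of n] unfolding r'_eq c1_def by (auto simp: abs_le_iff)
  have r1: "real (r m) \<le> \<alpha> * real m + 2" using r[of m] by linarith
  have "l \<le> n"
  proof -
    have "real l \<le> real n" using l2 n2 by (smt (verit) of_nat_0_le_iff zero_le_power)
    then show ?thesis by simp
  qed

  define E where "E = {\<sigma> :: bool list. length \<sigma> = m}"
  have card_strings: "card {\<sigma> :: bool list. length \<sigma> = j} = 2 ^ j"
      and fin_strings: "finite {\<sigma> :: bool list. length \<sigma> = j}" for j
    using card_lists_length_eq[of "UNIV :: bool set" j] finite_lists_length_eq[of "UNIV :: bool set" j]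
    by auto
  have fin: "finite E" and cardE: "card E = 2 ^ m" by (simp_all add: E_def card_strings fin_strings)
  have cardG: "card (\<Gamma> i ` E) \<le> 2 ^ n" if "i \<in> {1..k}" for i
    using card_mono[OF fin_strings, of "\<Gamma> i ` E" n] len that by (auto simp: E_def m_def card_strings)

  have "\<exists>A\<subseteq>E. (\<forall>i\<in>{1..k}. card (\<Gamma> i ` A) \<le> 2 ^ l) \<and> 2 ^ (r m + 2 * s) \<le> card A"
  proof -
    consider (small) "\<alpha> * real m + c2 \<le> \<beta> * real n"
      | (large) "real k * (1 - \<beta>) * real n + c3 \<le> (1 - \<alpha>) * real m"
      | (critical) "\<beta> * real n < \<alpha> * real m + c2" "(1 - \<alpha>) * real m < real k * (1 - \<beta>) * real n + c3"
      by linarith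
    then show ?thesis
    proof cases
      case small
      have "real (r m + 2 * s) \<le> real l" using small r1 l1 by (simp add: c2_def)
      then have le_l: "r m + 2 * s \<le> l" by linarith
      have "real (r m + 2 * s) \<le> real m" using r1 m1 by simp
      then have "2 ^ (r m + 2 * s) \<le> card E" unfolding cardE by (intro power_increasing) auto
      then obtain A where A: "A \<subseteq> E" "card A = 2 ^ (r m + 2 * s)" "finite A"
        by (rule obtain_subset_with_card_n)
      have "card (\<Gamma> i ` A) \<le> 2 ^ l" for i
        using card_image_le[OF A(3), of "\<Gamma> i"] power_increasing[OF le_l, of "2::nat"] A(2) by linarith
      then show ?thesis using A by auto
    next
      case large
      have "real n - real l \<le> (1 - \<beta>) * real n + c1" using l1 by (simp add: algebra_simps)
      then have "real k * (real n - real l) \<le> real k * ((1 - \<beta>) * real n + c1)"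
        by (rule mult_left_mono) simp
      then have "real (k * n + (r m + 2 * s)) \<le> real (k * l + m)"
        using large r1 by (simp add: c3_def algebra_simps)
      then have "k * n + (r m + 2 * s) \<le> k * l + m" by linarith
      then show ?thesis using heavy_fibres_power[of "{1..k}" E m \<Gamma> n l] fin cardE cardG \<open>l \<le> n\<close> by simp
    next
      case critical
      have "\<alpha> * (\<theta> * real n) < \<alpha> * (real m + c2 / \<alpha>)"
        using critical(1) \<alpha> by (simp add: \<theta>1 algebra_simps)
      then have m_lower: "\<theta> * real n < real m + c2 / \<alpha>" using \<alpha> by simp
      have "(1 - \<alpha>) * real m < (1 - \<alpha>) * (\<theta> * real n + c3 / (1 - \<alpha>))"
        using critical(2) \<alpha> \<theta>2 by (simp add: distrib_left flip: mult.assoc)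
      then have "real m < \<theta> * real n + c3 / (1 - \<alpha>)" using \<alpha> by simp
      then have "\<alpha> * real m < \<alpha> * (\<theta> * real n + c3 / (1 - \<alpha>))" using \<alpha> by simp
      then have m_upper: "\<alpha> * real m < \<beta> * real n + \<alpha> * (c3 / (1 - \<alpha>))"
        by (simp add: \<theta>1 distrib_left)
      have "real (r m + 2 * s) \<le> real (\<mu> + l)"
        using r1 l1 m_upper \<mu> by (simp add: c2_def)
      then have target: "r m + 2 * s \<le> \<mu> + l" by linarith
      have "real \<mu> \<le> real l" using n1 l1 by linarith
      then have "\<mu> \<le> l" by simp
      have "real (a + l + 2 ^ (a + \<mu>)) \<le> real n" using n2 l2 by simp
      then have wide: "a + l + 2 ^ (a + \<mu>) \<le> n" by linarith
      have "(real k - 1) * (real n - real l) \<le> (real k - 1) * ((1 - \<beta>) * real n + c1)"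
        using l1 k by (intro mult_left_mono) (simp_all add: algebra_simps)
      \<comment> \<open>By \<open>\<theta>3\<close>, the restrictions of k - 1 functions cost about
        (\<theta> - 1)n bits; one further n is the range of the remaining function.\<close>
      also have "\<dots> = (\<theta> - 1) * real n + (real k - 1) * c1"
        by (simp flip: \<theta>3 add: distrib_left mult.assoc)
      finally have "(real k - 1) * real n + (real n + real \<mu> + 1) \<le> (real k - 1) * real l + (real m + real a)"
        using m_lower a by (simp add: algebra_simps)
      then have "real ((k - 1) * n + (n + \<mu> + 1)) \<le> real ((k - 1) * l + (m + a))"
        using k by (simp add: of_nat_diff)
      then have "(k - 1) * n + (n + \<mu> + 1) \<le> (k - 1) * l + (m + a)" by linarith
      then obtain A where "A \<subseteq> E" "\<forall>i\<in>{1..k}. card (\<Gamma> i ` A) \<le> 2 ^ l" "2 ^ (\<mu> + l) \<le> card A"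
        using boosted_subset[of k E m \<Gamma> n \<mu> l a] k fin cardE cardG \<open>\<mu> \<le> l\<close> wide by blast
      moreover have "(2::nat) ^ (r m + 2 * s) \<le> 2 ^ (\<mu> + l)"
        using target by (intro power_increasing) auto
      ultimately show ?thesis by (meson order_trans)
    qed
  qed
  then show ?thesis using r'_eq unfolding E_def m_def by blast
qed

section \<open>Describing the images by a computable search\<close>

theorem theorem24:
  fixes U :: machine and k :: nat and \<alpha> \<beta> :: real
  assumes "optimal_machine U"
    and "k \<ge> 2"
    and "\<alpha> \<in> {0<..<1}" and "\<beta> \<in> {0<..<1}"
    and "computable_real \<alpha>" and "computable_real \<beta>"
    and "\<beta> = real k * \<alpha> / (1 + (real k - 1) * \<alpha>)"
  shows "(\<alpha>, \<beta>) \<notin> EXT U k"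
proof
  assume "(\<alpha>, \<beta>) \<in> EXT U k"
  then obtain f \<Gamma> d where f: "inj f" "computable_nat f"
    and \<Gamma>: "\<And>i. i \<in> {1..k} \<Longrightarrow> computable_str (\<Gamma> i)"
    and len: "\<And>n \<sigma> i. length \<sigma> = f n \<Longrightarrow> i \<in> {1..k} \<Longrightarrow> length (\<Gamma> i \<sigma>) = n"
    and complex: "\<And>n \<sigma>. length \<sigma> = f n \<Longrightarrow>
        \<alpha> * real (length \<sigma>) + real d \<le> real (plain_complexity U \<sigma>) \<Longrightarrow>
        \<exists>i\<in>{1..k}. \<beta> * real (length (\<Gamma> i \<sigma>)) - real d \<le> real (plain_complexity U (\<Gamma> i \<sigma>))"
    unfolding EXT_def by blast
  obtain r where r: "computable_nat r" "\<And>n. \<bar>real (r n) - \<alpha> * real n\<bar> \<le> 2"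
    using computable_real_multiples[OF assms(5)] assms(3) by auto
  obtain r' where r': "computable_nat r'" "\<And>n. \<bar>real (r' n) - \<beta> * real n\<bar> \<le> 2"
    using computable_real_multiples[OF assms(6)] assms(4) by auto
  \<comment> \<open>\<open>b\<close> codes a list of 2^(r' n - 3s) numbers, to contain the codes of
    all images of the string coded by \<open>x\<close>.\<close>
  define covered where "covered s n b x \<longleftrightarrow>
      (\<forall>i\<in>{1..k}. \<exists>j<2 ^ (r' n - 3 * s). code_nth b j = str_encode (\<Gamma> i (str_decode x)))" for s n b x
  define good where "good s n b \<longleftrightarrow> 3 * s \<le> r' n \<and>
      2 ^ (r (f n) + 2 * s) \<le> (\<Sum>y<2 ^ f n. of_bool (covered s n b (2 ^ f n - 1 + y)) :: nat)" for s n b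
  have good_card: "good s n b \<longleftrightarrow> 3 * s \<le> r' n \<and>
      2 ^ (r (f n) + 2 * s) \<le> card {\<sigma>. length \<sigma> = f n \<and> covered s n b (str_encode \<sigma>)}" for s n b
    unfolding good_def sum_strings_of_length ..
  have comp: "computable_nat (\<lambda>e. str_encode (\<Gamma> i (str_decode (h e))))"
    if "i \<in> {1..k}" "computable_nat h" for i h
    using computable_nat_comp[OF computable_str_encoded[OF \<Gamma>[OF that(1)]] that(2)] .
  have "decidable_nat (\<lambda>e. good (pfst e) (pfst (psnd e)) (psnd (psnd e)))"
    unfolding good_def covered_def
    by (intro computable_intros decidable_nat_ball comp computable_nat_comp[OF f(2)] computable_nat_comp[OF r(1)]
        computable_nat_comp[OF r'(1)]) simp_all
  then obtain M where M: "partial_computable M"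
    "\<And>s j l. \<exists>z. good s (pfst z) (psnd z) \<Longrightarrow> j < 2 ^ l \<Longrightarrow>
      \<exists>p. M p = Some (str_decode (code_nth (psnd (LEAST z. good s (pfst z) (psnd z))) j)) \<and> length p \<le> s + l"
    using search_machine[of "\<lambda>s z. good s (pfst z) (psnd z)"] by blast
  obtain c where c: "\<And>p \<sigma>. M p = Some \<sigma> \<Longrightarrow> \<exists>q. U q = Some \<sigma> \<and> length q \<le> length p + c"
    using M(1) assms(1) unfolding optimal_machine_def by meson
  \<comment> \<open>Large enough that 2s exceeds d + 2 in the counting of \<open>A\<close> and c + d
    + 2 in the final estimate.\<close>
  define s where "s = c + d + 4"

  have "\<exists>n b. good s n b"
  proof -
    have "\<exists>n l A. r' n = l + k + 3 * s \<and> A \<subseteq> {\<sigma>. length \<sigma> = f n} \<and>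
        (\<forall>i\<in>{1..k}. card (\<Gamma> i ` A) \<le> 2 ^ l) \<and> 2 ^ (r (f n) + 2 * s) \<le> card A"
      by (rule rich_set_exists[OF assms(2) _ _ _ _ assms(7) f(1)])
        (use assms(3,4) len r(2) r'(2) in \<open>simp_all\<close>)
    then obtain n l A where A: "r' n = l + k + 3 * s" "A \<subseteq> {\<sigma>. length \<sigma> = f n}"
        "\<And>i. i \<in> {1..k} \<Longrightarrow> card (\<Gamma> i ` A) \<le> 2 ^ l" "2 ^ (r (f n) + 2 * s) \<le> card A"
      by blast
    have finA: "finite A" using A(4) by (metis card.infinite not_one_le_zero one_le_numeral one_le_power order_trans)
    let ?B = "\<Union>i\<in>{1..k}. str_encode ` \<Gamma> i ` A"
    have "card ?B \<le> (\<Sum>i\<in>{1..k}. card (str_encode ` \<Gamma> i ` A))" by (rule card_UN_le) simp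
    also have "\<dots> \<le> (\<Sum>i\<in>{1..k}. 2 ^ l)"
      by (intro sum_mono order_trans[OF card_image_le A(3)]) (use finA in auto)
    also have "\<dots> \<le> 2 ^ k * 2 ^ l" by (simp add: less_imp_le)
    also have "\<dots> = 2 ^ (r' n - 3 * s)" by (simp add: A(1) power_add)
    finally obtain h :: "nat \<Rightarrow> nat" where h: "?B \<subseteq> h ` {..<2 ^ (r' n - 3 * s)}"
      using surj_onto_finite[of ?B "2 ^ (r' n - 3 * s)"] finA by auto
    obtain b where b: "\<forall>j<2 ^ (r' n - 3 * s). code_nth b j = h j" using code_nth_surj by blast
    have "covered s n b (str_encode \<sigma>)" if "\<sigma> \<in> A" for \<sigma>
      unfolding covered_def
    proof
      fix i assume "i \<in> {1..k}"
      then have "str_encode (\<Gamma> i \<sigma>) \<in> h ` {..<2 ^ (r' n - 3 * s)}" using h that by blast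
      then show "\<exists>j<2 ^ (r' n - 3 * s). code_nth b j = str_encode (\<Gamma> i (str_decode (str_encode \<sigma>)))"
        using b by auto
    qed
    then have "A \<subseteq> {\<sigma>. length \<sigma> = f n \<and> covered s n b (str_encode \<sigma>)}" using A(2) by auto
    moreover have "finite {\<sigma> :: bool list. length \<sigma> = f n \<and> covered s n b (str_encode \<sigma>)}"
      by (rule finite_subset[OF _ finite_lists_length_eq[of "UNIV :: bool set" "f n"]]) auto
    ultimately have "card A \<le> card {\<sigma>. length \<sigma> = f n \<and> covered s n b (str_encode \<sigma>)}"
      by (intro card_mono)
    then have "good s n b" unfolding good_card using A(1,4) by auto
    then show ?thesis by blast
  qed
  then have ex: "\<exists>z. good s (pfst z) (psnd z)" by (metis fst_conv snd_conv prod_encode_inverse)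
  \<comment> \<open>The very witness that \<open>M\<close> finds from \<open>s\<close>, so
    \<open>b\<close> need not be part of the program.\<close>
  define z where "z = (LEAST z. good s (pfst z) (psnd z))"
  define n where "n = pfst z"
  define b where "b = psnd z"
  define A where "A = {\<sigma>. length \<sigma> = f n \<and> covered s n b (str_encode \<sigma>)}"
  have "good s n b" unfolding n_def b_def z_def using ex by (rule LeastI_ex)
  then have rn: "3 * s \<le> r' n" and cardA: "2 ^ (r (f n) + 2 * s) \<le> card A"
    by (simp_all add: good_card A_def)

  \<comment> \<open>\<open>A\<close> outnumbers the strings of smaller complexity; the summand 2
    absorbs the error of \<open>r\<close>.\<close>
  have "\<exists>\<sigma>\<in>A. r (f n) + d + 2 \<le> plain_complexity U \<sigma>"
  proof (rule ccontr)
    assume "\<not> ?thesis"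
    then have "A \<subseteq> {\<sigma>. plain_complexity U \<sigma> < r (f n) + d + 2}" by (auto simp: not_le)
    then have "card A \<le> 2 ^ (r (f n) + d + 2)"
      using card_low_complexity[OF assms(1), of "r (f n) + d + 2"] card_mono order_trans by blast
    also have "\<dots> < 2 ^ (r (f n) + 2 * s)" by (intro power_strict_increasing) (auto simp: s_def)
    finally show False using cardA by simp
  qed
  then obtain \<sigma> where \<sigma>: "\<sigma> \<in> A" "r (f n) + d + 2 \<le> plain_complexity U \<sigma>" by blast
  have len\<sigma>: "length \<sigma> = f n" using \<sigma>(1) by (simp add: A_def)
  have "real (r (f n) + d + 2) \<le> real (plain_complexity U \<sigma>)" using \<sigma>(2) by (rule of_nat_mono)
  then have "\<alpha> * real (length \<sigma>) + real d \<le> real (plain_complexity U \<sigma>)"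
    using r(2)[of "f n"] by (simp add: len\<sigma>)
  from complex[OF len\<sigma> this] obtain i where i: "i \<in> {1..k}"
    "\<beta> * real n - real d \<le> real (plain_complexity U (\<Gamma> i \<sigma>))"
    using len[OF len\<sigma>] by auto
  obtain j where j: "j < 2 ^ (r' n - 3 * s)" "code_nth b j = str_encode (\<Gamma> i \<sigma>)"
    using \<sigma>(1) i(1) unfolding A_def covered_def mem_Collect_eq str_decode_encode by blast
  \<comment> \<open>The position \<open>j\<close> takes r' n - 3s bits and \<open>s\<close> itself
    another s, a saving of 2s bits against \<beta>n up to a constant.\<close>
  obtain p where p: "M p = Some (\<Gamma> i \<sigma>)" "length p \<le> s + (r' n - 3 * s)"
    using M(2)[OF ex j(1)] unfolding z_def[symmetric] b_def[symmetric] j(2) by auto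
  obtain q where q: "U q = Some (\<Gamma> i \<sigma>)" "length q \<le> length p + c" using c[OF p(1)] by blast
  have "plain_complexity U (\<Gamma> i \<sigma>) + 2 * s \<le> r' n + c"
    using plain_complexity_le[of U q, OF q(1)] q(2) p(2) rn by linarith
  then have "real (plain_complexity U (\<Gamma> i \<sigma>)) + 2 * real s \<le> real (r' n) + real c" by linarith
  then show False using i(2) r'(2)[of n] by (simp add: s_def)
qed

end
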